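(* Let $G$ be a graph and let $k\ge 1$ be an integer. Then $G$ is a $k$-median graph if and only if there are $k$ (distinct) vertices $\mu_1,\dots,\mu_k\in V(G)$ such that $G$ satisfies (C1) w.r.t. each of $\mu_1,\dots,\mu_k$. In this case (i.e. whenever $G$ satisfies (C1) w.r.t. $\mu_1,\dots,\mu_k$), the vertices $\mu_1,\dots,\mu_k$ are median-consistent vertices of $G$.
   Context: All graphs are finite, simple and undirected. For $x,y\in V(G)$, the interval $I_G(x,y)$ is the set of all vertices lying on shortest $(x,y)$-paths in $G$ (it is empty if $x,y$ lie in different connected components), and $I_G(x,y,z):=I_G(x,y)\cap I_G(x,z)\cap I_G(y,z)$. A vertex $\mu\in V(G)$ is median-consistent in $G$ if $|I_G(\mu,x,y)|=1$ for all $x,y\in V(G)$. A graph is a $k$-median graph ($k\geq 1$) if it has (at least) $k$ median-consistent vertices. For $W\subseteq V(G)$, $G[W]$ denotes the subgraph induced by $W$. For $u\in V(G)$, $G$ satisfies (C1) w.r.t. $u$ if, for all $v,w\in V(G)$, the induced subgraph $G[I_G(u,v,w)]$ contains at least one vertex and is connected. *)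

theory Defs
  imports "Graph_Theory.Digraph_Component" "Graph_Theory.Arc_Walk"
begin

text \<open>
  Finite simple undirected graphs are rendered by the locale predicate \<^const>\<open>graph\<close>: finite
  symmetric digraphs without loops and without parallel arcs, each undirected edge being a pair
  of opposite arcs.
\<close>

definition shortest_path :: "('a,'b) pre_digraph \<Rightarrow> 'a \<Rightarrow> 'b list \<Rightarrow> 'a \<Rightarrow> bool" where
  "shortest_path G x p y \<longleftrightarrow>
     pre_digraph.apath G x p y \<and> (\<forall>q. pre_digraph.apath G x q y \<longrightarrow> length p \<le> length q)"

definition interval :: "('a,'b) pre_digraph \<Rightarrow> 'a \<Rightarrow> 'a \<Rightarrow> 'a set" where
  "interval G x y = {z. \<exists>p. shortest_path G x p y \<and> z \<in> set (pre_digraph.awalk_verts G x p)}"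

definition interval3 :: "('a,'b) pre_digraph \<Rightarrow> 'a \<Rightarrow> 'a \<Rightarrow> 'a \<Rightarrow> 'a set" where
  "interval3 G x y z = interval G x y \<inter> interval G x z \<inter> interval G y z"

definition median_consistent :: "('a,'b) pre_digraph \<Rightarrow> 'a \<Rightarrow> bool" where
  "median_consistent G m \<longleftrightarrow>
     m \<in> verts G \<and> (\<forall>x\<in>verts G. \<forall>y\<in>verts G. card (interval3 G m x y) = 1)"

text \<open>
  Intended for graphs with finitely many vertices, where the cardinality below is meaningful.
\<close>

definition k_median_graph :: "nat \<Rightarrow> ('a,'b) pre_digraph \<Rightarrow> bool" where
  "k_median_graph k G \<longleftrightarrow> k \<le> card {m. median_consistent G m}"

text \<open>
  \<^const>\<open>connected\<close> requires a nonempty vertex set; nonemptiness is nevertheless listed explicitly.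
\<close>

definition C1 :: "('a,'b) pre_digraph \<Rightarrow> 'a \<Rightarrow> bool" where
  "C1 G u \<longleftrightarrow>
     (\<forall>v\<in>verts G. \<forall>w\<in>verts G.
        verts (G \<restriction> interval3 G u v w) \<noteq> {} \<and> connected (G \<restriction> interval3 G u v w))"

end

(*
  If G[I(u,v,w)] is connected and has two vertices, then it has an edge xy. Either d(u,x) = d(u,y),
  and then I(u,x,y) is empty, as it would have to contain x or y; or, say, d(u,y) = d(u,x) + 1,
  and then y is closer than x both to v and to w, so that x and y cannot both lie on shortest
  (v,w)-paths.
*)
theory Submission
  imports Defs
begin

text \<open>Walks concatenate freely, unlike paths, and a natural number suits linear arithmetic. If
  no walk leads from \<open>x\<close> to \<open>y\<close>, the value is unspecified, hence the
  reachability hypotheses below.\<close>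

definition (in pre_digraph) gdist :: "'a \<Rightarrow> 'a \<Rightarrow> nat" where
  "gdist x y = (LEAST n. \<exists>p. awalk x p y \<and> length p = n)"

context wf_digraph
begin

lemma gdist_le: "awalk x p y \<Longrightarrow> gdist x y \<le> length p"
  unfolding gdist_def by (rule Least_le) blast

lemma gdist_attained:
  assumes "x \<rightarrow>\<^sup>* y"
  obtains p where "awalk x p y" "length p = gdist x y"
proof -
  from assms have "\<exists>n p. awalk x p y \<and> length p = n" by (simp add: reachable_awalk)
  then have "\<exists>p. awalk x p y \<and> length p = gdist x y"
    unfolding gdist_def by (rule LeastI_ex)
  with that show thesis by blast
qed

text \<open>A repeated vertex encloses a nonempty closed subwalk \<open>r\<close>; cutting it out
  would leave a walk shorter than the distance.\<close>

lemma apath_if_length_le_gdist: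
  assumes p: "awalk x p y" and le: "length p \<le> gdist x y"
  shows "apath x p y"
proof (rule ccontr)
  assume "\<not> apath x p y"
  with p have "\<not> distinct (awalk_verts x p)" by (simp add: apath_def)
  from awalk_not_distinct_decomp[OF p this]
  obtain q r s w where "p = q @ r @ s" "0 < length r" "awalk x q w" "awalk w s y"
    by blast
  moreover from this have "awalk x (q @ s) y" by auto
  ultimately show False
    \<comment> \<open>The deleted simp rule would turn \<open>0 < length r\<close> into
      \<open>r \<noteq> []\<close>, out of reach of arithmetic.\<close>
    using gdist_le[of x "q @ s" y] le by (simp del: length_greater_0_conv)
qed

text \<open>Links minimality among paths to minimality among walks: a walk of minimal length is
  itself a path, so it competes in \<open>shortest_path\<close>.\<close>

lemma shortest_path_imp_awalk_gdist:
  assumes "shortest_path G x p y"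
  shows "awalk x p y" "length p = gdist x y"
proof -
  show p: "awalk x p y" using assms by (simp add: shortest_path_def apath_def)
  from p obtain q where q: "awalk x q y" "length q = gdist x y"
    using gdist_attained reachable_awalkI by metis
  with apath_if_length_le_gdist have "apath x q y" by simp
  with assms q have "length p \<le> gdist x y" by (auto simp: shortest_path_def)
  with gdist_le[OF p] show "length p = gdist x y" by simp
qed

lemma gdist_triangle:
  assumes "x \<rightarrow>\<^sup>* z" "z \<rightarrow>\<^sup>* y"
  shows "gdist x y \<le> gdist x z + gdist z y"
proof -
  obtain p q where "awalk x p z" "length p = gdist x z" "awalk z q y" "length q = gdist z y"
    using assms gdist_attained by metis
  moreover from this have "awalk x (p @ q) y" by auto
  ultimately show ?thesis using gdist_le[of x "p @ q" y] by simp
qed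

lemma gdist_eq_0_iff:
  assumes "x \<rightarrow>\<^sup>* y"
  shows "gdist x y = 0 \<longleftrightarrow> x = y"
proof
  assume "gdist x y = 0"
  with gdist_attained[OF assms] show "x = y" by (metis length_0_conv awalk_Nil_iff awalk_ends)
next
  assume "x = y"
  moreover have "x \<in> verts G" using assms by (rule reachable_in_verts)
  ultimately show "gdist x y = 0" using gdist_le[of x "[]" y] by (simp add: awalk_Nil_iff)
qed

lemma gdist_adjacent:
  assumes "x \<rightarrow> y" "x \<noteq> y"
  shows "gdist x y = 1"
proof -
  from assms(1) obtain e where "e \<in> arcs G" "tail G e = x" "head G e = y" by auto
  then have "awalk x [e] y" using arc_implies_awalk by metis
  then have "gdist x y \<le> 1" using gdist_le[of x "[e]" y] by simp
  moreover have "gdist x y \<noteq> 0" using assms gdist_eq_0_iff[OF reachable_adjI] by blast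
  ultimately show ?thesis by simp
qed

text \<open>Cutting a shortest path at \<open>z\<close> bounds the sum of the two distances from
  above; the triangle inequality bounds it from below. From here on intervals are handled through
  distances alone.\<close>

lemma intervalD:
  assumes "z \<in> interval G x y"
  shows "x \<rightarrow>\<^sup>* z" "z \<rightarrow>\<^sup>* y" "gdist x z + gdist z y = gdist x y"
proof -
  obtain p where p: "shortest_path G x p y" "z \<in> set (awalk_verts x p)"
    using assms by (auto simp: interval_def)
  note walk = shortest_path_imp_awalk_gdist[OF p(1)]
  obtain q r where qr: "p = q @ r" "awalk x q z" "awalk z r y"
    using awalk_decomp[OF walk(1) p(2)] by blast
  then show reach: "x \<rightarrow>\<^sup>* z" "z \<rightarrow>\<^sup>* y" by (auto intro: reachable_awalkI)
  from gdist_le[OF qr(2)] gdist_le[OF qr(3)] gdist_triangle[OF reach] walk(2) qr(1)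
  show "gdist x z + gdist z y = gdist x y" by simp
qed

lemma interval_adjacent:
  assumes "x \<rightarrow> y" "x \<noteq> y"
  shows "interval G x y \<subseteq> {x, y}"
proof
  fix z assume z: "z \<in> interval G x y"
  with gdist_adjacent[OF assms] have "gdist x z = 0 \<or> gdist z y = 0"
    using intervalD(3) by fastforce
  with intervalD[OF z] gdist_eq_0_iff show "z \<in> {x, y}" by blast
qed

end

context sym_digraph
begin

text \<open>Symmetry supplies an opposite arc for each arc; the induction appends these opposites in
  reverse order.\<close>

lemma awalk_reverse:
  assumes "awalk x p y"
  shows "\<exists>q. awalk y q x \<and> length q = length p"
  using assms
proof (induction p arbitrary: x)
  case Nil
  then show ?case by (auto simp: awalk_Nil_iff intro!: exI[of _ "[]"])
next
  case (Cons e p)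
  then have e: "e \<in> arcs G" "tail G e = x" and p: "awalk (head G e) p y"
    by (auto simp: awalk_Cons_iff)
  from Cons.IH[OF p] obtain q where q: "awalk y q (head G e)" "length q = length p" by blast
  from e have "x \<rightarrow> head G e" using in_arcs_imp_in_arcs_ends by blast
  then have "head G e \<rightarrow> x" by (rule graph_symmetric)
  then obtain e' where "e' \<in> arcs G" "tail G e' = head G e" "head G e' = x" by auto
  then have "awalk (head G e) [e'] x" using arc_implies_awalk by metis
  with q have "awalk y (q @ [e']) x" by auto
  with q(2) show ?case by (intro exI[of _ "q @ [e']"]) simp
qed

lemma gdist_sym:
  assumes "x \<rightarrow>\<^sup>* y"
  shows "gdist y x = gdist x y"
proof -
  have le: "gdist b a \<le> gdist a b" if "a \<rightarrow>\<^sup>* b" for a b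
    using gdist_attained[OF that] awalk_reverse gdist_le by metis
  have "y \<rightarrow>\<^sup>* x" using assms symmetric_reachable[OF sym_arcs] by blast
  with le assms show ?thesis by (simp add: antisym)
qed

lemma C1_imp_no_edge_in_interval3:
  assumes C1: "C1 G u" and "x \<rightarrow> y" "x \<noteq> y"
    and x: "x \<in> interval3 G u v w" and y: "y \<in> interval3 G u v w"
  shows False
proof -
  \<comment> \<open>Since arcs can be reversed, it suffices to treat an edge whose head is at least
    as far from \<open>u\<close> as its tail.\<close>
  have key: False
    if ab: "a \<rightarrow> b" "a \<noteq> b" and a: "a \<in> interval3 G u v w" and b: "b \<in> interval3 G u v w"
      and le: "gdist u a \<le> gdist u b" for a b
  proof -
    note a' = a[unfolded interval3_def, THEN IntD1, THEN IntD1, THEN intervalD(1)]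
      a[unfolded interval3_def, THEN IntD1, THEN IntD1, THEN intervalD(3)]
      a[unfolded interval3_def, THEN IntD1, THEN IntD2, THEN intervalD(3)]
      a[unfolded interval3_def, THEN IntD2, THEN intervalD(3)]
      a[unfolded interval3_def, THEN IntD2, THEN intervalD(1), THEN gdist_sym]
    note b' = b[unfolded interval3_def, THEN IntD1, THEN IntD1, THEN intervalD(1)]
      b[unfolded interval3_def, THEN IntD1, THEN IntD1, THEN intervalD(3)]
      b[unfolded interval3_def, THEN IntD1, THEN IntD2, THEN intervalD(3)]
      b[unfolded interval3_def, THEN IntD2, THEN intervalD(3)]
      b[unfolded interval3_def, THEN IntD2, THEN intervalD(1), THEN gdist_sym]
    have d: "gdist a b = 1" "gdist b a = 1"
      using gdist_adjacent ab graph_symmetric by blast+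
    show False
    proof (cases "gdist u a = gdist u b")
      case True
      have "a \<in> verts G" "b \<in> verts G" using ab adj_in_verts by blast+
      \<comment> \<open>(C1) is applied to the triple \<open>u\<close>, \<open>a\<close>,
        \<open>b\<close>. As \<open>z\<close> is an end of the edge, it lies on a shortest path from
        \<open>u\<close> to the other end, so the two distances from \<open>u\<close> would differ
        by 1.\<close>
      with C1 obtain z where z: "z \<in> interval G u a" "z \<in> interval G u b" "z \<in> interval G a b"
        unfolding C1_def interval3_def by force
      from z(3) interval_adjacent[OF ab] have "z = a \<or> z = b" by blast
      with intervalD(3)[OF z(1)] intervalD(3)[OF z(2)] d True show False by auto
    next
      case False
      have "gdist u b \<le> gdist u a + 1"
        using gdist_triangle[OF a'(1) reachable_adjI[OF ab(1)]] d by simp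
      \<comment> \<open>The distances via \<open>a\<close> and via \<open>b\<close> agree for each
        of the pairs \<open>u\<close>,\<open>v\<close> and \<open>u\<close>,\<open>w\<close> and
        \<open>v\<close>,\<open>w\<close>. As \<open>b\<close> is farther from \<open>u\<close>, the
        first two make it closer to both \<open>v\<close> and \<open>w\<close>, against the
        third.\<close>
      with False le a' b' show False by linarith
    qed
  qed
  show False
    using linear[of "gdist u x" "gdist u y"]
  proof
    assume "gdist u x \<le> gdist u y"
    with key[OF assms(2,3) x y] show False .
  next
    assume "gdist u y \<le> gdist u x"
    with key[OF graph_symmetric[OF assms(2)] assms(3)[symmetric] y x] show False .
  qed
qed

text \<open>A chain from \<open>x\<close> to \<open>y\<close> in the induced subgraph must at some
  step leave the current vertex. Loops are possible in \<open>sym_digraph\<close>, so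
  \<open>a \<noteq> b\<close> is recorded.\<close>

lemma connected_induce_imp_adjacent:
  assumes conn: "connected (G \<restriction> S)" and xy: "x \<in> S" "y \<in> S" "x \<noteq> y"
  obtains a b where "a \<in> S" "b \<in> S" "a \<rightarrow> b" "a \<noteq> b"
proof -
  \<comment> \<open>\<open>connected\<close> refers to the symmetric closure of the arcs; symmetry
    of \<open>G\<close> turns each of its steps back into an arc of \<open>G\<close>.\<close>
  have adj: "a \<in> S \<and> b \<in> S \<and> a \<rightarrow> b" if "(a, b) \<in> (arcs_ends (G \<restriction> S))\<^sup>s" for a b
    using that graph_symmetric by (auto simp: symcl_def arcs_ends_conv)
  have "(x, y) \<in> rtrancl_on S ((arcs_ends (G \<restriction> S))\<^sup>s)"
    using conn xy by (simp add: connected_conv)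
  then have "x = y \<or> (\<exists>a b. (a, b) \<in> (arcs_ends (G \<restriction> S))\<^sup>s \<and> a \<noteq> b)"
    by (induct rule: rtrancl_on_induct) auto
  with xy(3) adj that show thesis by blast
qed

lemma C1_imp_card_interval3:
  assumes C1: "C1 G u" and vw: "v \<in> verts G" "w \<in> verts G"
  shows "card (interval3 G u v w) = 1"
proof -
  let ?I = "interval3 G u v w"
  have ne: "?I \<noteq> {}" and conn: "connected (G \<restriction> ?I)"
    using C1 vw by (auto simp: C1_def)
  have "x = y" if xy: "x \<in> ?I" "y \<in> ?I" for x y
  proof (rule ccontr)
    assume "x \<noteq> y"
    with connected_induce_imp_adjacent[OF conn xy]
    obtain a b where "a \<in> ?I" "b \<in> ?I" "a \<rightarrow> b" "a \<noteq> b" by metis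
    with C1_imp_no_edge_in_interval3[OF C1] show False by metis
  qed
  then have "is_singleton ?I" using ne by (rule is_singletonI'[rotated])
  then show ?thesis by (simp add: is_singleton_altdef)
qed

lemma connected_induce_singleton: "connected (G \<restriction> {z})"
  by (auto simp: connected_conv)

text \<open>The theorem for a single vertex. One direction holds because a one-vertex graph is
  connected, the other because connectedness without edges leaves only one vertex.\<close>

lemma median_consistent_iff_C1: "median_consistent G u \<longleftrightarrow> u \<in> verts G \<and> C1 G u"
proof
  assume u: "median_consistent G u"
  have "verts (G \<restriction> interval3 G u v w) \<noteq> {} \<and> connected (G \<restriction> interval3 G u v w)"
    if "v \<in> verts G" "w \<in> verts G" for v w
  proof -
    from u that have "card (interval3 G u v w) = 1" by (simp add: median_consistent_def)
    then obtain z where "interval3 G u v w = {z}" by (rule card_1_singletonE)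
    then show ?thesis by (simp add: connected_induce_singleton)
  qed
  with u show "u \<in> verts G \<and> C1 G u" by (simp add: C1_def median_consistent_def)
next
  assume "u \<in> verts G \<and> C1 G u"
  then show "median_consistent G u" by (simp add: median_consistent_def C1_imp_card_interval3)
qed

end

theorem mainTheorem2:
  fixes G :: "('a,'b) pre_digraph" and k :: nat
  assumes "graph G" and "k \<ge> 1"
  shows "(k_median_graph k G \<longleftrightarrow>
            (\<exists>M. M \<subseteq> verts G \<and> card M = k \<and> (\<forall>\<mu>\<in>M. C1 G \<mu>))) \<and>
         (\<forall>M. M \<subseteq> verts G \<and> card M = k \<and> (\<forall>\<mu>\<in>M. C1 G \<mu>) \<longrightarrow>
            (\<forall>\<mu>\<in>M. median_consistent G \<mu>))"
proof -
  interpret graph G by fact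
  let ?N = "{m. median_consistent G m}"
  have fin: "finite ?N"
    using finite_verts by (rule rev_finite_subset) (auto simp: median_consistent_def)
  \<comment> \<open>The sets \<open>M\<close> of the theorem are thus the \<open>k\<close>-element
    subsets of \<open>?N\<close>, which gives both the equivalence and the final claim.\<close>
  have sub: "M \<subseteq> ?N \<longleftrightarrow> M \<subseteq> verts G \<and> (\<forall>\<mu>\<in>M. C1 G \<mu>)" for M
    by (auto simp: median_consistent_iff_C1)
  \<comment> \<open>At least \<open>k\<close> becomes exactly \<open>k\<close> by passing to a
    subset; the converse is monotonicity of \<open>card\<close> on the finite set
    \<open>?N\<close>.\<close>
  have "k \<le> card ?N \<longleftrightarrow> (\<exists>M\<subseteq>?N. card M = k)"
    using fin by (metis card_mono obtain_subset_with_card_n)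
  then have "k_median_graph k G \<longleftrightarrow>
      (\<exists>M. M \<subseteq> verts G \<and> card M = k \<and> (\<forall>\<mu>\<in>M. C1 G \<mu>))"
    unfolding k_median_graph_def sub by (simp only: conj_assoc conj_left_commute conj_commute)
  moreover have "\<forall>\<mu>\<in>M. median_consistent G \<mu>"
    if "M \<subseteq> verts G \<and> card M = k \<and> (\<forall>\<mu>\<in>M. C1 G \<mu>)" for M
    using that sub[of M] by auto
  ultimately show ?thesis by simp
qed

end
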